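(* Let $0<m<L$ and let $\mathcal A\in\mathbb R^{n\times n}$, $\mathcal B\in\mathbb R^{n\times d}$, $\mathcal C\in\mathbb R^{d\times n}$ be such that $(\mathcal A,\mathcal C)$ is detectable. (i) Suppose that for every quadratic function $f\in\mathcal S_{m,L}$ and every $x_0\in\mathbb R^n$, the trajectory of $$x_{k+1}=\mathcal A x_k+\mathcal B w_k,\quad z_k=\mathcal C x_k,\quad w_k=\nabla f(z_k)\qquad(k\in\mathbb N_0)$$ satisfies $\lim_{k\to\infty}z_k=z_*$ for some $z_*\in\mathbb R^d$ and $\lim_{k\to\infty}w_k=0$. Then $\mathcal A+\mathcal B m\mathcal C$ is Schur and $(\mathcal A,\mathcal B,\mathcal C)$ admits the integrator factorization, i.e., there exist matrices $A_a,B_a,C_a,D_a$ and an invertible $T\in\mathbb R^{n\times n}$ with $$T^{-1}\mathcal A T=\begin{pmatrix}I_d&0\\ B_a&A_a\end{pmatrix},\qquad T^{-1}\mathcal B=\begin{pmatrix}I_d\\0\end{pmatrix},\qquad \mathcal C T=\begin{pmatrix}D_a&C_a\end{pmatrix}.$$ (ii) If $(\mathcal A,\mathcal C)$ has the structure induced by this factorization (i.e. $T^{-1}\mathcal AT=\begin{pmatrix}I_d&0\\ B_a&A_a\end{pmatrix}$ and $\mathcal CT=\begin{pmatrix}D_a&C_a\end{pmatrix}$ for some invertible $T$ and some matrices $A_a,B_a,C_a,D_a$), then for every $z_*\in\mathbb R^d$ the equations $x_*=\mathcal A x_*$, $z_*=\mathcal C x_*$ have a unique solution $x_*\in\mathbb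 R^n$.
   Context: $\mathcal S_{m,L}$ is the class of all $C^1$-functions $f:\mathbb R^d\to\mathbb R$ with $[\nabla f(x)-\nabla f(y)]^T(x-y)\ge m\|x-y\|^2$ and $\|\nabla f(x)-\nabla f(y)\|\le L\|x-y\|$ for all $x,y\in\mathbb R^d$. A square real matrix is Schur if all its eigenvalues have absolute value strictly less than one. $(\mathcal A,\mathcal C)$ is detectable if there exists a matrix $M$ such that $\mathcal A+M\mathcal C$ is Schur. Here $A_a\in\mathbb R^{(n-d)\times(n-d)}$, $B_a\in\mathbb R^{(n-d)\times d}$, $C_a\in\mathbb R^{d\times(n-d)}$, $D_a\in\mathbb R^{d\times d}$. The factorization expresses that, after a state-coordinate change, the linear system $(\mathcal A,\mathcal B,\mathcal C,0)$ is the series interconnection of the discrete-time integrator $\eta_{k+1}=\eta_k+w_k$, $y_k=\eta_k$ (acting first) and the system $(A_a,B_a,C_a,D_a)$ (acting second). *)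

theory Defs
  imports
    "HOL-Analysis.Analysis"
    "HOL-Library.Countable_Set"
    "Jordan_Normal_Form.Char_Poly"
begin

text \<open>
  Vectors, gradients and trajectories live in the Euclidean spaces \<open>real ^ 'n\<close> and \<open>real ^ 'd\<close>.
  Since no index type is available for the dimension \<open>n - d\<close> (which may be \<open>0\<close>), eigenvalues and
  block partitions are expressed after a transfer to matrices of the AFP entry Jordan_Normal_Form,
  whose dimensions are natural numbers. The library of Jordan_Normal_Form reuses the
  infix notations for vector components and inner products, hence the long forms
  \<open>vec_nth\<close> and \<open>inner\<close> below.
\<close>


subsection \<open>Transfer to matrices with numerical dimensions\<close>

text \<open>
  Coordinates are listed in the order of a fixed but unspecified enumeration
  \<open>from_nat_into UNIV\<close> of each index type; the same enumeration is used for rows and columns.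
\<close>

definition to_mat :: "real ^ 'c ^ 'r \<Rightarrow> real mat" where
  "to_mat M = Matrix.mat CARD('r) CARD('c)
     (\<lambda>(i, j). vec_nth (vec_nth M (from_nat_into UNIV i)) (from_nat_into UNIV j))"

lemma bij_betw_from_nat_into_UNIV:
  "bij_betw (from_nat_into (UNIV :: 'a::finite set)) {..<CARD('a)} UNIV"
  by (rule bij_betw_from_nat_into_finite) simp

lemma to_mat_carrier: "to_mat (M :: real ^ 'c ^ 'r) \<in> carrier_mat CARD('r) CARD('c)"
  by (simp add: to_mat_def)

lemma to_mat_mult: "to_mat (M ** N) = to_mat M * to_mat N"
  for M :: "real ^ 'k ^ 'r" and N :: "real ^ 'c ^ 'k"
proof (rule eq_matI)
  fix i j
  assume "i < dim_row (to_mat M * to_mat N)" "j < dim_col (to_mat M * to_mat N)"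
  hence ij: "i < CARD('r)" "j < CARD('c)" by (simp_all add: to_mat_def)
  let ?e = "from_nat_into (UNIV :: 'k set)"
  let ?g = "\<lambda>k. vec_nth (vec_nth M (from_nat_into UNIV i)) k * vec_nth (vec_nth N k) (from_nat_into UNIV j)"
  have "(\<Sum>k\<in>UNIV. ?g k) = (\<Sum>k\<in>{..<CARD('k)}. ?g (?e k))"
    by (rule sum.reindex_bij_betw [OF bij_betw_from_nat_into_UNIV, symmetric])
  thus "to_mat (M ** N) $$ (i, j) = (to_mat M * to_mat N) $$ (i, j)"
    using ij by (simp add: to_mat_def matrix_matrix_mult_def scalar_prod_def atLeast0LessThan)
qed (simp_all add: to_mat_def)


subsection \<open>Schur matrices and detectability\<close>

definition schur :: "real ^ 'n ^ 'n \<Rightarrow> bool" where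
  "schur A \<longleftrightarrow>
     (\<forall>\<mu>. eigenvalue (map_mat complex_of_real (to_mat A)) \<mu> \<longrightarrow> cmod \<mu> < 1)"

definition detectable :: "real ^ 'n ^ 'n \<Rightarrow> real ^ 'n ^ 'd \<Rightarrow> bool" where
  "detectable A C \<longleftrightarrow> (\<exists>M :: real ^ 'd ^ 'n. schur (A + M ** C))"


subsection \<open>The function class\<close>

definition gradient :: "(real ^ 'd \<Rightarrow> real) \<Rightarrow> real ^ 'd \<Rightarrow> real ^ 'd" where
  "gradient f x = (THE g. GDERIV f x :> g)"

definition S_class :: "real \<Rightarrow> real \<Rightarrow> (real ^ 'd \<Rightarrow> real) set" where
  "S_class m L = {f.
     (\<forall>x. f differentiable (at x)) \<and> continuous_on UNIV (gradient f) \<and>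
     (\<forall>x y. inner (gradient f x - gradient f y) (x - y) \<ge> m * (norm (x - y))\<^sup>2) \<and>
     (\<forall>x y. norm (gradient f x - gradient f y) \<le> L * norm (x - y))}"

text \<open>Symmetry of \<open>Q\<close> is no restriction on \<open>f\<close> and therefore not demanded.\<close>

definition quadratic_fun :: "(real ^ 'd \<Rightarrow> real) \<Rightarrow> bool" where
  "quadratic_fun f \<longleftrightarrow>
     (\<exists>(Q :: real ^ 'd ^ 'd) b c. \<forall>z. f z = 1 / 2 * inner z (Q *v z) + inner b z + c)"


subsection \<open>Interconnection and factorization\<close>

definition closed_loop ::
  "real ^ 'n ^ 'n \<Rightarrow> real ^ 'd ^ 'n \<Rightarrow> real ^ 'n ^ 'd \<Rightarrow> (real ^ 'd \<Rightarrow> real)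
    \<Rightarrow> (nat \<Rightarrow> real ^ 'n) \<Rightarrow> (nat \<Rightarrow> real ^ 'd) \<Rightarrow> (nat \<Rightarrow> real ^ 'd) \<Rightarrow> bool" where
  "closed_loop A B C f x z w \<longleftrightarrow>
     (\<forall>k. x (Suc k) = A *v x k + B *v w k \<and> z k = C *v x k \<and> w k = gradient f (z k))"

text \<open>
  The rectangular partitions into one block row or one block column are written as
  \<open>four_block_mat\<close> with empty (zero-row or zero-column) remaining blocks.
\<close>

definition block_row :: "real mat \<Rightarrow> real mat \<Rightarrow> real mat" where
  "block_row X Y = four_block_mat X Y (0\<^sub>m 0 (dim_col X)) (0\<^sub>m 0 (dim_col Y))"

definition block_col :: "real mat \<Rightarrow> real mat \<Rightarrow> real mat" where
  "block_col X Y = four_block_mat X (0\<^sub>m (dim_row X) 0) Y (0\<^sub>m (dim_row Y) 0)"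

definition integrator_structure_AC ::
  "real ^ 'n ^ 'n \<Rightarrow> real ^ 'n ^ 'd \<Rightarrow> real ^ 'n ^ 'n
    \<Rightarrow> real mat \<Rightarrow> real mat \<Rightarrow> real mat \<Rightarrow> real mat \<Rightarrow> bool" where
  "integrator_structure_AC A C T Aa Ba Ca Da \<longleftrightarrow>
     (let n = CARD('n); d = CARD('d) in
        d \<le> n \<and> invertible T \<and>
        Aa \<in> carrier_mat (n - d) (n - d) \<and> Ba \<in> carrier_mat (n - d) d \<and>
        Ca \<in> carrier_mat d (n - d) \<and> Da \<in> carrier_mat d d \<and>
        to_mat (matrix_inv T ** A ** T) = four_block_mat (1\<^sub>m d) (0\<^sub>m d (n - d)) Ba Aa \<and>
        to_mat (C ** T) = block_row Da Ca)"

definition integrator_factorization ::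
  "real ^ 'n ^ 'n \<Rightarrow> real ^ 'd ^ 'n \<Rightarrow> real ^ 'n ^ 'd \<Rightarrow> real ^ 'n ^ 'n
    \<Rightarrow> real mat \<Rightarrow> real mat \<Rightarrow> real mat \<Rightarrow> real mat \<Rightarrow> bool" where
  "integrator_factorization A B C T Aa Ba Ca Da \<longleftrightarrow>
     integrator_structure_AC A C T Aa Ba Ca Da \<and>
     to_mat (matrix_inv T ** B) = block_col (1\<^sub>m CARD('d)) (0\<^sub>m (CARD('n) - CARD('d)) CARD('d))"

end

theory Submission
  imports Defs
begin

text \<open>
  The functions \<open>f z = m/2 \<bar>z\<bar>\<^sup>2 + b \<cdot> z\<close> suffice for part (i). With \<open>b = 0\<close> the loop is
  \<open>x\<^sub>k\<^sub>+\<^sub>1 = S x\<^sub>k\<close>, \<open>S = A + m B C\<close>, and its output vanishes in the limit, so detectability makes \<open>S\<close>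
  Schur. Hence \<open>K = I - S\<close> is invertible, and the loop for \<open>b\<close> started at its fixed point
  \<open>K\<^sup>-\<^sup>1 B b\<close> is constant; \<open>w \<rightarrow> 0\<close> then forces \<open>m C K\<^sup>-\<^sup>1 B = - I\<close>. So \<open>P = - m C K\<^sup>-\<^sup>1\<close> satisfies
  \<open>P B = I\<close>, and \<open>P K = - m C\<close> becomes \<open>P A = P\<close>. The columns of \<open>T\<close> are those of \<open>B\<close> followed by a
  basis of the kernel of \<open>P\<close>.

  In part (ii), the first \<open>d\<close> rows of \<open>T\<^sup>-\<^sup>1 (A - I)\<close> vanish. Filling them with \<open>C\<close> gives a square
  matrix, injective by detectability and therefore bijective.
\<close>

notation vec_nth (infixl "$h" 90)
notation vec_index (infixl "$v" 90)

section \<open>Linear maps with a right inverse\<close>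

text \<open>The splitting \<open>x = R (P x) + (x - R (P x))\<close> makes the space the direct sum
  of the range of \<open>R\<close> and the kernel of \<open>P\<close>; the former has dimension
  \<open>DIM('b)\<close> because \<open>R\<close> is injective.\<close>

lemma dim_kernel_right_inverse:
  fixes P :: "'a::euclidean_space \<Rightarrow> 'b::euclidean_space"
  assumes "linear P" "linear R" and PR: "\<And>z. P (R z) = z"
  shows "dim {x. P x = 0} + DIM('b) = DIM('a)"
proof -
  interpret P: linear P by fact
  interpret R: linear R by fact
  have sub: "subspace (range R)" "subspace {x. P x = 0}"
    using \<open>linear P\<close> \<open>linear R\<close> by (auto intro: linear_subspace_image linear_subspace_kernel)
  have "inj R" by (metis PR injI)
  hence "dim (range R) = DIM('b)"
    using dim_image_eq[OF \<open>linear R\<close>, of UNIV] by simp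
  moreover have "range R \<inter> {x. P x = 0} = {0}"
    using PR by (auto simp: R.zero P.zero) (metis R.zero rangeI)
  moreover have "{x + y |x y. x \<in> range R \<and> y \<in> {x. P x = 0}} = UNIV"
  proof -
    have "x \<in> {x + y |x y. x \<in> range R \<and> y \<in> {x. P x = 0}}" for x
    proof -
      have "x = R (P x) + (x - R (P x))" "P (x - R (P x)) = 0"
        by (auto simp: P.diff PR)
      thus ?thesis by blast
    qed
    thus ?thesis by blast
  qed
  ultimately show ?thesis
    using dim_sums_Int[OF sub] by simp
qed

text \<open>The kernels of \<open>P\<close> and \<open>Q\<close> have equal dimension, so an
  isomorphism between them can be glued to the map sending \<open>E z\<close> to \<open>R z\<close>.
  This supplies the change of basis for the factorization.\<close>

lemma linear_isomorphism_intertwining: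
  fixes P Q :: "'a::euclidean_space \<Rightarrow> 'b::euclidean_space"
  assumes "linear P" "linear Q" "linear R" "linear E"
    and PR: "\<And>z. P (R z) = z" and QE: "\<And>z. Q (E z) = z"
  obtains T where "linear T" "inj T" "\<And>z. T (E z) = R z" "\<And>x. P (T x) = Q x"
proof -
  interpret P: linear P by fact
  interpret Q: linear Q by fact
  interpret R: linear R by fact
  interpret E: linear E by fact
  have dim: "dim {x. Q x = 0} = dim {x. P x = 0}"
    using dim_kernel_right_inverse[OF \<open>linear P\<close> \<open>linear R\<close> PR]
      dim_kernel_right_inverse[OF \<open>linear Q\<close> \<open>linear E\<close> QE] by simp
  obtain f where "linear f" and f: "f ` {x. Q x = 0} = {x. P x = 0}"
    and f0: "\<And>x. Q x = 0 \<Longrightarrow> f x = 0 \<Longrightarrow> x = 0"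
  proof -
    have "subspace {x. Q x = 0}" "subspace {x. P x = 0}"
      using \<open>linear P\<close> \<open>linear Q\<close> by (auto intro: linear_subspace_kernel)
    then obtain f where "linear f" "f ` {x. Q x = 0} = {x. P x = 0}" "inj_on f {x. Q x = 0}"
      using subspace_isomorphism[OF _ _ dim] by auto
    moreover from this have "x = 0" if "Q x = 0" "f x = 0" for x
      using that Q.zero linear_0[OF \<open>linear f\<close>] by (auto dest: inj_onD[where x = x and y = 0])
    ultimately show thesis using that by blast
  qed
  interpret f: linear f by fact
  \<comment> \<open>\<open>E (Q x)\<close> and \<open>x - E (Q x)\<close> are the components of
    \<open>x\<close> in the range of \<open>E\<close> and in the kernel of \<open>Q\<close>;
    \<open>R (Q x)\<close> is the prescribed image of the first.\<close>
  define T where "T = (\<lambda>x. R (Q x) + f (x - E (Q x)))"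
  have "linear T"
    unfolding T_def
    by (rule linearI)
      (simp_all add: Q.add Q.scale E.add E.scale R.add R.scale f.add f.diff f.scale algebra_simps)
  moreover have TE: "T (E z) = R z" for z by (simp add: T_def QE f.zero)
  moreover have PT: "P (T x) = Q x" for x
  proof -
    have "Q (x - E (Q x)) = 0" by (simp add: Q.diff QE)
    hence "P (f (x - E (Q x))) = 0" using f by blast
    thus ?thesis by (simp add: T_def P.add PR)
  qed
  moreover have "x = 0" if "T x = 0" for x
  proof -
    have "Q x = 0" using PT[of x] that P.zero by simp
    moreover from this have "f x = 0" using that by (simp add: T_def E.zero R.zero)
    ultimately show ?thesis by (rule f0)
  qed
  hence "inj T" using \<open>linear T\<close> by (simp add: linear_injective_0)
  ultimately show thesis using that by blast
qed

section \<open>Enumerated indices and matrix entries\<close>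

lemma from_nat_into_UNIV_eq_iff:
  assumes "i < CARD('a::finite)" "j < CARD('a)"
  shows "from_nat_into (UNIV :: 'a set) i = from_nat_into UNIV j \<longleftrightarrow> i = j"
  using bij_betw_from_nat_into_UNIV[where 'a='a] assms
  by (auto simp: bij_betw_def dest: inj_onD)

lemma to_nat_on_UNIV_less: "to_nat_on (UNIV :: 'a::finite set) a < CARD('a)"
  using to_nat_on_finite[of "UNIV :: 'a set"] by (auto simp: bij_betw_def)

lemma to_nat_on_from_nat_into_UNIV:
  "i < CARD('a::finite) \<Longrightarrow> to_nat_on (UNIV :: 'a set) (from_nat_into UNIV i) = i"
  using from_nat_into_UNIV_eq_iff[OF to_nat_on_UNIV_less, of i "from_nat_into UNIV i :: 'a"] by simp

lemma all_from_nat_into_UNIV: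
  "(\<forall>i<CARD('a::finite). Q (from_nat_into (UNIV :: 'a set) i)) \<longleftrightarrow> (\<forall>a. Q a)"
proof
  assume *: "\<forall>i<CARD('a). Q (from_nat_into (UNIV :: 'a set) i)"
  show "\<forall>a. Q a"
  proof
    fix a :: 'a
    show "Q a" using *[rule_format, OF to_nat_on_UNIV_less, of a] by simp
  qed
qed simp

lemma to_mat_eq_iff:
  fixes M :: "real ^ 'c ^ 'r"
  shows "to_mat M = X \<longleftrightarrow> X \<in> carrier_mat CARD('r) CARD('c) \<and>
    (\<forall>i<CARD('r). \<forall>j<CARD('c). X $$ (i, j) = M $h from_nat_into UNIV i $h from_nat_into UNIV j)"
  by (auto simp: to_mat_def intro!: eq_matI)

section \<open>Complex eigenvectors as pairs of real vectors\<close>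

text \<open>Since \<open>S\<close> is real, it acts on \<open>v = p + i q\<close> by acting on
  \<open>p\<close> and \<open>q\<close> separately; the right-hand side is the real and imaginary
  part of \<open>S v = \<mu> v\<close>.\<close>

lemma mult_complex_vec_eq_iff:
  fixes S :: "real ^ 'n ^ 'n" and p q :: "real ^ 'n"
  defines "v \<equiv> Matrix.vec CARD('n)
    (\<lambda>i. Complex (p $h from_nat_into UNIV i) (q $h from_nat_into UNIV i))"
  shows "map_mat complex_of_real (to_mat S) *\<^sub>v v = \<mu> \<cdot>\<^sub>v v \<longleftrightarrow>
    S *v p = Re \<mu> *\<^sub>R p - Im \<mu> *\<^sub>R q \<and> S *v q = Im \<mu> *\<^sub>R p + Re \<mu> *\<^sub>R q"
proof -
  let ?e = "from_nat_into (UNIV :: 'n set)"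
  have row: "(map_mat complex_of_real (to_mat S) *\<^sub>v v) $v i =
      Complex ((S *v p) $h ?e i) ((S *v q) $h ?e i)" if "i < CARD('n)" for i
  proof -
    have "(map_mat complex_of_real (to_mat S) *\<^sub>v v) $v i =
        (\<Sum>k<CARD('n). complex_of_real (S $h ?e i $h ?e k) * Complex (p $h ?e k) (q $h ?e k))"
      using that by (simp add: v_def to_mat_def scalar_prod_def atLeast0LessThan)
    also have "\<dots> = (\<Sum>k\<in>UNIV. complex_of_real (S $h ?e i $h k) * Complex (p $h k) (q $h k))"
      by (rule sum.reindex_bij_betw[OF bij_betw_from_nat_into_UNIV])
    also have "\<dots> = Complex ((S *v p) $h ?e i) ((S *v q) $h ?e i)"
      by (simp add: complex_eq_iff matrix_vector_mult_def)
    finally show ?thesis .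
  qed
  have "map_mat complex_of_real (to_mat S) *\<^sub>v v = \<mu> \<cdot>\<^sub>v v \<longleftrightarrow>
      (\<forall>i<CARD('n). Complex ((S *v p) $h ?e i) ((S *v q) $h ?e i) =
         \<mu> * Complex (p $h ?e i) (q $h ?e i))"
    using row by (auto simp: vec_eq_iff v_def to_mat_def)
  also have "\<dots> \<longleftrightarrow> (\<forall>k. Complex ((S *v p) $h k) ((S *v q) $h k) = \<mu> * Complex (p $h k) (q $h k))"
    by (rule all_from_nat_into_UNIV)
  also have "\<dots> \<longleftrightarrow> S *v p = Re \<mu> *\<^sub>R p - Im \<mu> *\<^sub>R q \<and> S *v q = Im \<mu> *\<^sub>R p + Re \<mu> *\<^sub>R q"
    by (auto simp: complex_eq_iff Finite_Cartesian_Product.vec_eq_iff algebra_simps)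
  finally show ?thesis .
qed

text \<open>\<open>p\<close> and \<open>q\<close> are the real and imaginary parts of a complex eigenvector.\<close>

lemma eigenvalue_to_mat_iff:
  fixes S :: "real ^ 'n ^ 'n"
  shows "eigenvalue (map_mat complex_of_real (to_mat S)) \<mu> \<longleftrightarrow>
    (\<exists>p q. (p \<noteq> 0 \<or> q \<noteq> 0) \<and> S *v p = Re \<mu> *\<^sub>R p - Im \<mu> *\<^sub>R q \<and> S *v q = Im \<mu> *\<^sub>R p + Re \<mu> *\<^sub>R q)"
    (is "?L \<longleftrightarrow> ?R")
proof -
  let ?e = "from_nat_into (UNIV :: 'n set)"
  let ?v = "\<lambda>p q :: real ^ 'n. Matrix.vec CARD('n) (\<lambda>i. Complex (p $h ?e i) (q $h ?e i))"
  have v0: "?v p q = 0\<^sub>v CARD('n) \<longleftrightarrow> p = 0 \<and> q = 0" for p q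
  proof -
    have "?v p q = 0\<^sub>v CARD('n) \<longleftrightarrow> (\<forall>i<CARD('n). p $h ?e i = 0 \<and> q $h ?e i = 0)"
      by (auto simp: vec_eq_iff complex_eq_iff)
    also have "\<dots> \<longleftrightarrow> (\<forall>k. p $h k = 0 \<and> q $h k = 0)"
      by (rule all_from_nat_into_UNIV)
    finally show ?thesis by (auto simp: Finite_Cartesian_Product.vec_eq_iff)
  qed
  have ex: "\<exists>p q. v = ?v p q" if "v \<in> carrier_vec CARD('n)" for v
  proof (intro exI)
    show "v = ?v (\<chi> k. Re (v $v to_nat_on UNIV k)) (\<chi> k. Im (v $v to_nat_on UNIV k))"
      using that by (auto simp: vec_eq_iff to_nat_on_from_nat_into_UNIV)
  qed
  have dim: "dim_row (to_mat S) = CARD('n)" by (simp add: to_mat_def)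
  show ?thesis
  proof
    assume ?L
    then obtain v where v: "v \<in> carrier_vec CARD('n)" "v \<noteq> 0\<^sub>v CARD('n)"
        "map_mat complex_of_real (to_mat S) *\<^sub>v v = \<mu> \<cdot>\<^sub>v v"
      by (auto simp: eigenvalue_def eigenvector_def dim)
    obtain p q where "v = ?v p q" using ex[OF v(1)] by blast
    thus ?R using v(2,3) v0 mult_complex_vec_eq_iff[of S p q \<mu>] by auto
  next
    assume ?R
    then obtain p q where "p \<noteq> 0 \<or> q \<noteq> 0" "S *v p = Re \<mu> *\<^sub>R p - Im \<mu> *\<^sub>R q"
        "S *v q = Im \<mu> *\<^sub>R p + Re \<mu> *\<^sub>R q" by blast
    hence "eigenvector (map_mat complex_of_real (to_mat S)) (?v p q) \<mu>"
      using v0[of p q] mult_complex_vec_eq_iff[of S p q \<mu>] by (auto simp: eigenvector_def dim)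
    thus ?L by (auto simp: eigenvalue_def)
  qed
qed

section \<open>Schur matrices and detectability\<close>

lemma schur_fixed_point_zero:
  fixes S :: "real ^ 'n ^ 'n"
  assumes "schur S" "S *v x = x"
  shows "x = 0"
proof (rule ccontr)
  assume "x \<noteq> 0"
  hence "eigenvalue (map_mat complex_of_real (to_mat S)) 1"
    unfolding eigenvalue_to_mat_iff using assms(2)
    by (intro exI[of _ x] exI[of _ "0 :: real ^ 'n"]) simp
  thus False using \<open>schur S\<close> by (auto simp: schur_def)
qed

text \<open>Output injection does not act on a vector with zero output, so \<open>x\<close> is also
  fixed by the Schur matrix \<open>A + M ** C\<close>.\<close>

lemma detectable_fixed_point_zero:
  assumes "detectable A C" "A *v x = x" "C *v x = 0"
  shows "x = 0"
proof -
  obtain M where "schur (A + M ** C)" using assms(1) by (auto simp: detectable_def)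
  moreover have "(A + M ** C) *v x = x"
    using assms(2,3) by (simp add: matrix_vector_mult_add_rdistrib flip: matrix_vector_mul_assoc)
  ultimately show ?thesis by (rule schur_fixed_point_zero)
qed

text \<open>An eigenvector of \<open>S\<close> with eigenvalue \<open>\<mu>\<close>, \<open>\<bar>\<mu>\<bar> \<ge> 1\<close>, must be annihilated by \<open>C\<close> if the output
  \<open>C S\<^sup>k x\<close> always vanishes in the limit; output injection then does not move the eigenvalue.\<close>

lemma schur_if_output_vanishes:
  fixes A :: "real ^ 'n ^ 'n" and C :: "real ^ 'n ^ 'd"
  assumes "detectable A C"
    and lim: "\<And>x. (\<lambda>k. C *v (((*v) (A + G ** C)) ^^ k) x) \<longlonglongrightarrow> 0"
  shows "schur (A + G ** C)"
proof -
  let ?S = "A + G ** C"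
  obtain M where M: "schur (A + M ** C)" using assms(1) by (auto simp: detectable_def)
  have "cmod \<mu> < 1" if ev: "eigenvalue (map_mat complex_of_real (to_mat ?S)) \<mu>" for \<mu>
  proof (rule ccontr)
    assume "\<not> cmod \<mu> < 1"
    hence ge1: "(Re \<mu>)\<^sup>2 + (Im \<mu>)\<^sup>2 \<ge> 1" by (simp add: cmod_def)
    obtain p q where pq0: "p \<noteq> 0 \<or> q \<noteq> 0" and p: "?S *v p = Re \<mu> *\<^sub>R p - Im \<mu> *\<^sub>R q"
      and q: "?S *v q = Im \<mu> *\<^sub>R p + Re \<mu> *\<^sub>R q"
      using ev by (auto simp: eigenvalue_to_mat_iff)
    define pk where "pk k = (((*v) ?S) ^^ k) p" for k
    define qk where "qk k = (((*v) ?S) ^^ k) q" for k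
    have inv: "?S *v pk k = Re \<mu> *\<^sub>R pk k - Im \<mu> *\<^sub>R qk k \<and> ?S *v qk k = Im \<mu> *\<^sub>R pk k + Re \<mu> *\<^sub>R qk k" for k
    proof (induction k)
      case 0
      thus ?case using p q by (simp add: pk_def qk_def)
    next
      case (Suc k)
      have "pk (Suc k) = ?S *v pk k" "qk (Suc k) = ?S *v qk k" by (simp_all add: pk_def qk_def)
      thus ?case using Suc
        by (metis matrix_vector_mult_diff_distrib matrix_vector_right_distrib
            matrix_vector_mult_scaleR)
    qed
    \<comment> \<open>This is the squared norm of
      \<open>C S^k (p + i q) = \<mu>^k C (p + i q)\<close>, so each step multiplies it by the
      squared modulus of \<open>\<mu>\<close>.\<close>
    define s where "s k = (norm (C *v pk k))\<^sup>2 + (norm (C *v qk k))\<^sup>2" for k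
    have s_Suc: "s (Suc k) = ((Re \<mu>)\<^sup>2 + (Im \<mu>)\<^sup>2) * s k" for k
    proof -
      have step: "pk (Suc k) = Re \<mu> *\<^sub>R pk k - Im \<mu> *\<^sub>R qk k"
          "qk (Suc k) = Im \<mu> *\<^sub>R pk k + Re \<mu> *\<^sub>R qk k"
        using inv[of k] by (simp_all add: pk_def qk_def)
      show ?thesis
        unfolding s_def power2_norm_eq_inner step
        by (simp add: matrix_vector_mult_diff_distrib matrix_vector_right_distrib
            matrix_vector_mult_scaleR inner_add inner_diff inner_commute power2_eq_square algebra_simps)
    qed
    have s_nonneg: "s k \<ge> 0" for k by (simp add: s_def)
    have s_ge: "s k \<ge> s 0" for k
    proof (induction k)
      case (Suc k)
      have "1 * s k \<le> s (Suc k)" unfolding s_Suc by (rule mult_right_mono[OF ge1 s_nonneg])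
      thus ?case using Suc by simp
    qed simp
    have "s \<longlonglongrightarrow> (norm (0 :: real ^ 'd))\<^sup>2 + (norm (0 :: real ^ 'd))\<^sup>2"
      unfolding s_def pk_def qk_def by (intro tendsto_intros lim)
    \<comment> \<open>A sequence that never falls below its initial value and tends to
      \<open>0\<close> cannot start above \<open>0\<close>.\<close>
    hence "s 0 \<le> 0" using s_ge by (intro LIMSEQ_le_const[of s 0]) auto
    hence "C *v p = 0" "C *v q = 0" by (simp_all add: s_def pk_def qk_def sum_power2_le_zero_iff)
    hence "(A + M ** C) *v p = ?S *v p" "(A + M ** C) *v q = ?S *v q"
      by (simp_all add: matrix_vector_mult_add_rdistrib flip: matrix_vector_mul_assoc)
    hence "eigenvalue (map_mat complex_of_real (to_mat (A + M ** C))) \<mu>"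
      using p q pq0 by (auto simp: eigenvalue_to_mat_iff)
    thus False using M \<open>\<not> cmod \<mu> < 1\<close> by (auto simp: schur_def)
  qed
  thus ?thesis by (simp add: schur_def)
qed

section \<open>Gradients and quadratic test functions\<close>

lemma gradient_eqI:
  assumes "GDERIV f x :> g"
  shows "gradient f x = g"
  unfolding gradient_def
proof (rule the_equality)
  fix g' assume "GDERIV f x :> g'"
  hence "(\<lambda>h. inner h g') = (\<lambda>h. inner h g)"
    using assms unfolding gderiv_def by (rule has_derivative_unique)
  thus "g' = g" by (metis inner_commute vector_eq_ldot)
qed (fact assms)

text \<open>The gradient \<open>m z + b\<close> closes the loop to the affine recursion with linear
  part \<open>A + m B C\<close> and constant term \<open>B b\<close>; varying \<open>b\<close>
  shifts the minimizer when \<open>m > 0\<close>.\<close>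

definition isotropic_quadratic :: "real \<Rightarrow> real ^ 'd \<Rightarrow> real ^ 'd \<Rightarrow> real" where
  "isotropic_quadratic m b z = m / 2 * inner z z + inner b z"

lemma GDERIV_isotropic_quadratic: "GDERIV (isotropic_quadratic m b) x :> m *\<^sub>R x + b"
  unfolding gderiv_def isotropic_quadratic_def
  by (auto intro!: derivative_eq_intros simp: inner_add inner_commute algebra_simps)

lemma gradient_isotropic_quadratic: "gradient (isotropic_quadratic m b) x = m *\<^sub>R x + b"
  by (rule gradient_eqI[OF GDERIV_isotropic_quadratic])

lemma quadratic_fun_isotropic_quadratic: "quadratic_fun (isotropic_quadratic m b)"
  unfolding quadratic_fun_def isotropic_quadratic_def
  by (rule exI[of _ "m *\<^sub>R Finite_Cartesian_Product.mat 1"], rule exI[of _ b], rule exI[of _ 0])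
    (simp add: scaleR_matrix_vector_assoc[symmetric])

text \<open>Gradient differences are exactly \<open>m (x - y)\<close>: strong monotonicity holds
  with equality, and the Lipschitz constant is \<open>m \<le> L\<close>.\<close>

lemma isotropic_quadratic_in_S_class:
  assumes "0 \<le> m" "m \<le> L"
  shows "isotropic_quadratic m b \<in> S_class m L"
proof -
  have "gradient (isotropic_quadratic m b) = (\<lambda>x. m *\<^sub>R x + b)"
    by (rule ext) (rule gradient_isotropic_quadratic)
  moreover have "isotropic_quadratic m b differentiable (at x)" for x
    using GDERIV_isotropic_quadratic by (auto simp: gderiv_def intro: differentiableI)
  ultimately show ?thesis
    using assms unfolding S_class_def
    by (auto simp: power2_norm_eq_inner mult_right_mono simp flip: scaleR_diff_right
        intro!: continuous_intros)
qed

section \<open>Block partitions acting on vectors\<close>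

text \<open>The \<open>i\<close>-th coordinate of \<open>real ^ 'd\<close> and the coordinate \<open>block_index i\<close> of \<open>real ^ 'n\<close> have the
  same number in the enumerations used by \<open>to_mat\<close>.\<close>

definition block_index :: "'d::finite \<Rightarrow> 'n::finite" where
  "block_index i = from_nat_into UNIV (to_nat_on UNIV i)"

lemma block_index_from_nat_into:
  "i < CARD('d::finite) \<Longrightarrow> block_index (from_nat_into UNIV i :: 'd) = from_nat_into UNIV i"
  by (simp add: block_index_def to_nat_on_from_nat_into_UNIV)

text \<open>The numbers assigned to \<open>'d\<close> all lie below \<open>CARD('n)\<close>, where
  the enumeration of \<open>'n\<close> is injective.\<close>

lemma inj_block_index:
  assumes "CARD('d::finite) \<le> CARD('n::finite)"
  shows "inj (block_index :: 'd \<Rightarrow> 'n)"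
proof (rule injI)
  fix i j :: 'd
  assume "block_index i = (block_index j :: 'n)"
  hence "to_nat_on UNIV i = to_nat_on UNIV j"
    using from_nat_into_UNIV_eq_iff[where 'a='n] to_nat_on_UNIV_less[of i] to_nat_on_UNIV_less[of j] assms
    unfolding block_index_def by (metis order_less_le_trans)
  thus "i = j" by simp
qed

text \<open>The action of the block row \<open>(I 0)\<close>, with no index type of size
  \<open>n - d\<close>.\<close>

definition block_restrict :: "real ^ 'n \<Rightarrow> real ^ 'd" where
  "block_restrict x = (\<chi> i. x $h block_index i)"

text \<open>The action of the block column with \<open>I\<close> above \<open>0\<close>; the default
  \<open>0\<close> fills the lower block.\<close>

definition block_embed :: "real ^ 'd \<Rightarrow> real ^ 'n" where
  "block_embed z = (\<chi> k. if k \<in> range (block_index :: 'd \<Rightarrow> 'n) then z $h inv_into UNIV block_index k else 0)"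

lemma linear_block_restrict: "linear block_restrict"
  by (rule linearI) (simp_all add: block_restrict_def Finite_Cartesian_Product.vec_eq_iff)

lemma linear_block_embed: "linear block_embed"
  by (rule linearI) (auto simp: block_embed_def Finite_Cartesian_Product.vec_eq_iff)

lemma block_restrict_embed:
  fixes z :: "real ^ 'd"
  assumes "CARD('d) \<le> CARD('n::finite)"
  shows "block_restrict (block_embed z :: real ^ 'n) = z"
  using inj_block_index[OF assms]
  by (simp add: block_restrict_def block_embed_def Finite_Cartesian_Product.vec_eq_iff)

lemma matrix_inv_mult_vec:
  fixes T :: "real ^ 'n ^ 'n"
  assumes "invertible T"
  shows "matrix_inv T *v (T *v x) = x" "T *v (matrix_inv T *v x) = x"
proof -
  have "T ** matrix_inv T = Finite_Cartesian_Product.mat 1 \<and>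
      matrix_inv T ** T = Finite_Cartesian_Product.mat 1"
    using assms unfolding invertible_def matrix_inv_def by (rule someI_ex)
  thus "matrix_inv T *v (T *v x) = x" "T *v (matrix_inv T *v x) = x"
    by (simp_all add: matrix_vector_mul_assoc)
qed

lemma matrix_entry: "(M :: real ^ 'c ^ 'r) $h i $h j = (M *v axis j 1) $h i"
  by (simp add: matrix_vector_mult_basis column_def)

section \<open>Block equations as identities of linear maps\<close>

text \<open>The blocks \<open>Ba\<close>, \<open>Aa\<close>, \<open>Da\<close>, \<open>Ca\<close>
  can be read off from the transformed matrices, so the only constraint on the entries is that the
  first \<open>d\<close> rows of \<open>T^-1 A T\<close> are \<open>(I 0)\<close>.\<close>

lemma integrator_structure_AC_iff:
  fixes A T :: "real ^ 'n ^ 'n" and C :: "real ^ 'n ^ 'd"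
  shows "(\<exists>Aa Ba Ca Da. integrator_structure_AC A C T Aa Ba Ca Da) \<longleftrightarrow>
    CARD('d) \<le> CARD('n) \<and> invertible T \<and>
    (\<forall>x. (block_restrict (matrix_inv T *v (A *v (T *v x))) :: real ^ 'd) = block_restrict x)"
    (is "?L \<longleftrightarrow> ?R")
proof -
  let ?n = "CARD('n)" and ?d = "CARD('d)"
  let ?e = "from_nat_into (UNIV :: 'n set)"
  define N where "N = matrix_inv T ** A ** T"
  have Nmult: "N *v x = matrix_inv T *v (A *v (T *v x))" for x
    by (simp add: N_def flip: matrix_vector_mul_assoc)
  have rows: "(\<forall>x. (block_restrict (N *v x) :: real ^ 'd) = block_restrict x) \<longleftrightarrow>
      (\<forall>i<?d. \<forall>j<?n. N $h ?e i $h ?e j = (if i = j then 1 else 0))" if dn: "?d \<le> ?n"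
  proof -
    have "(\<forall>x. (block_restrict (N *v x) :: real ^ 'd) = block_restrict x) \<longleftrightarrow>
        (\<forall>i::'d. \<forall>x. (N *v x) $h block_index i = x $h block_index i)"
      by (auto simp: block_restrict_def Finite_Cartesian_Product.vec_eq_iff)
    also have "\<dots> \<longleftrightarrow> (\<forall>i::'d. \<forall>k. N $h block_index i $h k = (if block_index i = k then 1 else 0))"
    proof (intro all_cong1 iffI allI)
      fix i :: 'd and k
      assume "\<forall>x. (N *v x) $h block_index i = x $h block_index i"
      thus "N $h block_index i $h k = (if block_index i = k then 1 else 0)"
        by (simp add: matrix_entry axis_def)
    next
      fix i :: 'd and x
      assume *: "\<forall>k. N $h block_index i $h k = (if block_index i = k then 1 else 0)"
      show "(N *v x) $h block_index i = x $h block_index i"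
        unfolding matrix_vector_mult_def by (simp add: * if_distrib[of "\<lambda>t. t * _"] cong: if_cong)
    qed
    also have "\<dots> \<longleftrightarrow> (\<forall>i<?d. \<forall>k. N $h ?e i $h k = (if ?e i = k then 1 else 0))"
      by (simp add: block_index_from_nat_into flip: all_from_nat_into_UNIV[where 'a='d])
    also have "\<dots> \<longleftrightarrow> (\<forall>i<?d. \<forall>j<?n. N $h ?e i $h ?e j = (if ?e i = ?e j then 1 else 0))"
      by (simp only: flip: all_from_nat_into_UNIV[where 'a='n])
    also have "\<dots> \<longleftrightarrow> (\<forall>i<?d. \<forall>j<?n. N $h ?e i $h ?e j = (if i = j then 1 else 0))"
      using dn by (simp add: from_nat_into_UNIV_eq_iff)
    finally show ?thesis .
  qed
  show ?thesis
  proof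
    assume ?L
    then obtain Aa Ba Ca Da where dn: "?d \<le> ?n" and "invertible T"
      and car: "Aa \<in> carrier_mat (?n - ?d) (?n - ?d)" "Ba \<in> carrier_mat (?n - ?d) ?d"
      and eq: "to_mat N = four_block_mat (1\<^sub>m ?d) (0\<^sub>m ?d (?n - ?d)) Ba Aa"
      by (auto simp: integrator_structure_AC_def Let_def N_def)
    have "N $h ?e i $h ?e j = (if i = j then 1 else 0)" if "i < ?d" "j < ?n" for i j
    proof -
      have "four_block_mat (1\<^sub>m ?d) (0\<^sub>m ?d (?n - ?d)) Ba Aa $$ (i, j) = N $h ?e i $h ?e j"
        using eq that dn unfolding to_mat_eq_iff by (meson order_less_le_trans)
      thus ?thesis using that car dn by (auto split: if_splits)
    qed
    thus ?R using rows[OF dn] dn \<open>invertible T\<close> by (simp add: Nmult)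
  next
    assume R: ?R
    hence dn: "?d \<le> ?n" and top: "\<And>i j. i < ?d \<Longrightarrow> j < ?n \<Longrightarrow>
        N $h ?e i $h ?e j = (if i = j then 1 else 0)"
      using rows by (simp_all add: Nmult)
    \<comment> \<open>The shift by \<open>?d\<close> skips the first block of rows or
      columns.\<close>
    define Aa where "Aa = Matrix.mat (?n - ?d) (?n - ?d) (\<lambda>(i, j). N $h ?e (i + ?d) $h ?e (j + ?d))"
    define Ba where "Ba = Matrix.mat (?n - ?d) ?d (\<lambda>(i, j). N $h ?e (i + ?d) $h ?e j)"
    define Ca where "Ca = Matrix.mat ?d (?n - ?d)
      (\<lambda>(i, j). (C ** T) $h from_nat_into UNIV i $h ?e (j + ?d))"
    define Da where "Da = Matrix.mat ?d ?d (\<lambda>(i, j). (C ** T) $h from_nat_into UNIV i $h ?e j)"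
    have "to_mat N = four_block_mat (1\<^sub>m ?d) (0\<^sub>m ?d (?n - ?d)) Ba Aa"
      using dn by (auto simp: to_mat_eq_iff Aa_def Ba_def top)
    moreover have "to_mat (C ** T) = block_row Da Ca"
      using dn by (auto simp: to_mat_eq_iff block_row_def Ca_def Da_def)
    moreover have "Aa \<in> carrier_mat (?n - ?d) (?n - ?d)" "Ba \<in> carrier_mat (?n - ?d) ?d"
        "Ca \<in> carrier_mat ?d (?n - ?d)" "Da \<in> carrier_mat ?d ?d"
      by (simp_all add: Aa_def Ba_def Ca_def Da_def)
    ultimately show ?L using R unfolding integrator_structure_AC_def Let_def N_def by blast
  qed
qed

text \<open>The additional equation for \<open>B\<close> does not involve the four blocks;
  multiplied by \<open>T\<close>, it says that the first \<open>d\<close> columns of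
  \<open>T\<close> are those of \<open>B\<close>.\<close>

lemma integrator_factorization_iff:
  fixes A T :: "real ^ 'n ^ 'n" and B :: "real ^ 'd ^ 'n" and C :: "real ^ 'n ^ 'd"
  shows "(\<exists>Aa Ba Ca Da. integrator_factorization A B C T Aa Ba Ca Da) \<longleftrightarrow>
    CARD('d) \<le> CARD('n) \<and> invertible T \<and>
    (\<forall>x. (block_restrict (matrix_inv T *v (A *v (T *v x))) :: real ^ 'd) = block_restrict x) \<and>
    (\<forall>z. T *v block_embed z = B *v z)"
    (is "?L \<longleftrightarrow> ?R")
proof -
  let ?n = "CARD('n)" and ?d = "CARD('d)"
  let ?e = "from_nat_into (UNIV :: 'n set)" and ?e' = "from_nat_into (UNIV :: 'd set)"
  have "to_mat (matrix_inv T ** B) = block_col (1\<^sub>m ?d) (0\<^sub>m (?n - ?d) ?d) \<longleftrightarrow>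
      (\<forall>z. T *v block_embed z = B *v z)" if dn: "?d \<le> ?n" and T: "invertible T"
  proof -
    let ?N = "matrix_inv T ** B"
    have embed: "block_embed (axis (?e' j) 1) = (axis (?e j) 1 :: real ^ 'n)" if "j < ?d" for j
    proof -
      have "block_embed (axis k 1) = (axis (block_index k) 1 :: real ^ 'n)" for k :: 'd
        using inj_block_index[where 'd='d and 'n='n, OF dn]
        by (auto simp: block_embed_def Finite_Cartesian_Product.vec_eq_iff axis_def)
      thus ?thesis using block_index_from_nat_into[OF that] by metis
    qed
    have embed_nth: "(block_embed (axis (?e' j) 1) :: real ^ 'n) $h ?e i = (if i = j then 1 else 0)"
      if "i < ?n" "j < ?d" for i j
      unfolding embed[OF that(2)] using that dn by (simp add: axis_def from_nat_into_UNIV_eq_iff)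
    have "to_mat ?N = block_col (1\<^sub>m ?d) (0\<^sub>m (?n - ?d) ?d) \<longleftrightarrow>
        (\<forall>i<?n. \<forall>j<?d. ?N $h ?e i $h ?e' j = (if i = j then 1 else 0))"
      using dn by (auto simp: to_mat_eq_iff block_col_def)
    also have "\<dots> \<longleftrightarrow> (\<forall>i<?n. \<forall>j<?d. (?N *v axis (?e' j) 1) $h ?e i =
        (block_embed (axis (?e' j) 1) :: real ^ 'n) $h ?e i)"
      by (simp add: embed_nth matrix_entry[of ?N] split del: if_split)
    also have "\<dots> \<longleftrightarrow> (\<forall>k l. (?N *v axis l 1) $h k = (block_embed (axis l 1) :: real ^ 'n) $h k)"
      by (simp only: all_from_nat_into_UNIV[of "\<lambda>l. (?N *v axis l 1) $h _ = block_embed (axis l 1) $h _"]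
          all_from_nat_into_UNIV[of "\<lambda>k. \<forall>l. (?N *v axis l 1) $h k = block_embed (axis l 1) $h k"])
    also have "\<dots> \<longleftrightarrow> (\<forall>z. ?N *v z = block_embed z)"
    proof
      assume "\<forall>k l. (?N *v axis l 1) $h k = (block_embed (axis l 1) :: real ^ 'n) $h k"
      hence "?N *v axis l 1 = block_embed (axis l 1)" for l
        by (simp add: Finite_Cartesian_Product.vec_eq_iff)
      hence "(*v) ?N = block_embed"
        by (intro linear_eq_stdbasis[OF matrix_vector_mul_linear linear_block_embed])
          (auto simp: Basis_vec_def)
      thus "\<forall>z. ?N *v z = block_embed z" by metis
    qed simp
    also have "\<dots> \<longleftrightarrow> (\<forall>z. T *v block_embed z = B *v z)"
      using matrix_inv_mult_vec[OF T] by (metis matrix_vector_mul_assoc)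
    finally show ?thesis .
  qed
  moreover have "?L \<longleftrightarrow> (\<exists>Aa Ba Ca Da. integrator_structure_AC A C T Aa Ba Ca Da) \<and>
      to_mat (matrix_inv T ** B) = block_col (1\<^sub>m ?d) (0\<^sub>m (?n - ?d) ?d)"
    by (auto simp: integrator_factorization_def)
  ultimately show ?thesis unfolding integrator_structure_AC_iff by blast
qed

section \<open>Constructing the factorization\<close>

text \<open>The rows of \<open>P\<close> are left eigenvectors of \<open>A\<close> for the
  eigenvalue 1, dual to the columns of \<open>B\<close>. Take \<open>T\<close> with
  \<open>P T = (I 0)\<close> and with \<open>B\<close> as its first \<open>d\<close> columns. Then
  \<open>(I 0) T^-1 A T = P A T = P T = (I 0)\<close>.\<close>

lemma integrator_factorization_if_left_eigenvectors:
  fixes A :: "real ^ 'n ^ 'n" and B :: "real ^ 'd ^ 'n" and C :: "real ^ 'n ^ 'd" and P :: "real ^ 'n ^ 'd"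
  assumes PA: "\<And>x. P *v (A *v x) = P *v x" and PB: "\<And>z. P *v (B *v z) = z"
  shows "\<exists>T Aa Ba Ca Da. integrator_factorization A B C T Aa Ba Ca Da"
proof -
  have "inj ((*v) B)" by (metis PB injI)
  hence dn: "CARD('d) \<le> CARD('n)"
    using dim_image_eq[OF matrix_vector_mul_linear[of B], of UNIV] dim_subset_UNIV[of "range ((*v) B)"]
    by simp
  obtain t :: "real ^ 'n \<Rightarrow> real ^ 'n" where "linear t" "inj t" and t: "\<And>z. t (block_embed z) = B *v z"
      "\<And>x. P *v t x = block_restrict x"
    by (rule linear_isomorphism_intertwining[OF matrix_vector_mul_linear[of P] linear_block_restrict
        matrix_vector_mul_linear[of B] linear_block_embed PB block_restrict_embed[OF dn]])
      (rule that)
  define T where "T = matrix t"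
  have Tt: "T *v x = t x" for x
    unfolding T_def using fun_cong[OF matrix_vector_mul(2)[OF \<open>linear t\<close>]] by simp
  hence "invertible T"
    using \<open>inj t\<close> by (auto simp: invertible_left_inverse matrix_left_invertible_injective inj_def)
  have "block_restrict (matrix_inv T *v (A *v (T *v x))) = (block_restrict x :: real ^ 'd)" for x
    using matrix_inv_mult_vec(2)[OF \<open>invertible T\<close>] by (metis PA Tt t(2))
  hence "\<exists>Aa Ba Ca Da. integrator_factorization A B C T Aa Ba Ca Da"
    unfolding integrator_factorization_iff using dn \<open>invertible T\<close> t(1) by (simp add: Tt)
  thus ?thesis by blast
qed

lemma schur_and_integrator_factorization:
  fixes A :: "real ^ 'n ^ 'n" and B :: "real ^ 'd ^ 'n" and C :: "real ^ 'n ^ 'd"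
  assumes "0 < m" and det: "detectable A C"
    and lim: "\<And>b x z w. closed_loop A B C (isotropic_quadratic m b) x z w \<Longrightarrow> w \<longlonglongrightarrow> 0"
  shows "schur (A + m *\<^sub>R (B ** C))"
    and "\<exists>T Aa Ba Ca Da. integrator_factorization A B C T Aa Ba Ca Da"
proof -
  let ?S = "A + m *\<^sub>R (B ** C)"
  have S: "?S *v x = A *v x + m *\<^sub>R (B *v (C *v x))" for x
    by (simp add: matrix_vector_mult_add_rdistrib scaleR_matrix_vector_assoc[symmetric]
        matrix_vector_mul_assoc)
  have "(\<lambda>k. C *v (((*v) ?S) ^^ k) x) \<longlonglongrightarrow> 0" for x
  proof -
    \<comment> \<open>For \<open>b = 0\<close> the feedback is \<open>w = m z\<close>, so the
      iterates of \<open>?S\<close> form a trajectory; dividing its input by \<open>m\<close> gives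
      the output.\<close>
    have "closed_loop A B C (isotropic_quadratic m 0) (\<lambda>k. (((*v) ?S) ^^ k) x)
        (\<lambda>k. C *v (((*v) ?S) ^^ k) x) (\<lambda>k. m *\<^sub>R (C *v (((*v) ?S) ^^ k) x))"
      by (simp add: closed_loop_def gradient_isotropic_quadratic S matrix_vector_mult_scaleR)
    from tendsto_scaleR[OF tendsto_const[of "1 / m"] lim[OF this]] show ?thesis
      using \<open>0 < m\<close> by simp
  qed
  moreover have S_eq: "?S = A + (m *\<^sub>R B) ** C" by (simp add: scalar_matrix_assoc)
  ultimately show schur: "schur ?S"
    using schur_if_output_vanishes[OF det, of "m *\<^sub>R B"] by simp
  let ?K = "Finite_Cartesian_Product.mat 1 - ?S"
  have K: "?K *v x = x - A *v x - m *\<^sub>R (B *v (C *v x))" for x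
    by (simp add: matrix_vector_mult_diff_rdistrib S)
  \<comment> \<open>The kernel of \<open>?K = I - ?S\<close> consists of the fixed points of
    \<open>?S\<close>.\<close>
  have "x = 0" if "?K *v x = 0" for x
    using that schur_fixed_point_zero[OF schur, of x] by (simp add: matrix_vector_mult_diff_rdistrib)
  hence "invertible ?K"
    by (auto simp: invertible_left_inverse matrix_left_invertible_ker)
  define R where "R = matrix_inv ?K"
  have KR: "?K *v (R *v x) = x" and RK: "R *v (?K *v x) = x" for x
    using matrix_inv_mult_vec[OF \<open>invertible ?K\<close>] by (simp_all add: R_def)
  \<comment> \<open>\<open>R B b\<close> is an equilibrium for the offset \<open>b\<close>; its
    constant input \<open>m C R B b + b\<close> tends to \<open>0\<close> only by being
    \<open>0\<close>.\<close>
  have out: "m *\<^sub>R (C *v (R *v (B *v b))) = - b" for b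
  proof -
    let ?x = "R *v (B *v b)"
    have "?x = A *v ?x + B *v (m *\<^sub>R (C *v ?x) + b)"
      using KR[of "B *v b"] unfolding K
      by (simp add: matrix_vector_right_distrib matrix_vector_mult_scaleR algebra_simps)
    hence "closed_loop A B C (isotropic_quadratic m b)
        (\<lambda>k. ?x) (\<lambda>k. C *v ?x) (\<lambda>k. m *\<^sub>R (C *v ?x) + b)"
      by (simp add: closed_loop_def gradient_isotropic_quadratic)
    from lim[OF this] show ?thesis
      by (simp add: LIMSEQ_const_iff eq_neg_iff_add_eq_0)
  qed
  \<comment> \<open>The factor \<open>- m\<close> turns \<open>out\<close> into
    \<open>P B = I\<close>.\<close>
  define P where "P = - m *\<^sub>R (C ** R)"
  have P: "P *v x = - (m *\<^sub>R (C *v (R *v x)))" for x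
    unfolding P_def scaleR_matrix_vector_assoc[symmetric] by (simp add: matrix_vector_mul_assoc)
  have PB: "P *v (B *v z) = z" for z
    by (simp add: P out)
  have "P *v (A *v x) = P *v x" for x
  proof -
    \<comment> \<open>\<open>P K\<close> is computed twice: from \<open>R K = I\<close> it is
      \<open>- m C\<close>, and by expanding \<open>K\<close> with \<open>P B = I\<close> it is
      \<open>P - P A - m C\<close>.\<close>
    have "P *v (?K *v x) = - (m *\<^sub>R (C *v x))" unfolding P RK ..
    moreover have "P *v (?K *v x) = P *v x - P *v (A *v x) - m *\<^sub>R (C *v x)"
      unfolding K by (simp add: matrix_vector_mult_diff_distrib matrix_vector_mult_scaleR PB)
    ultimately show ?thesis by simp
  qed
  thus "\<exists>T Aa Ba Ca Da. integrator_factorization A B C T Aa Ba Ca Da"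
    using PB by (rule integrator_factorization_if_left_eigenvectors)
qed

section \<open>Existence and uniqueness of equilibria\<close>

lemma unique_equilibrium:
  fixes A T :: "real ^ 'n ^ 'n" and C :: "real ^ 'n ^ 'd"
  assumes det: "detectable A C" and "integrator_structure_AC A C T Aa Ba Ca Da"
  shows "\<exists>!x. x = A *v x \<and> z = C *v x"
proof -
  have "\<exists>Aa Ba Ca Da. integrator_structure_AC A C T Aa Ba Ca Da"
    using assms(2) by blast
  from iffD1[OF integrator_structure_AC_iff this] have dn: "CARD('d) \<le> CARD('n)" and T: "invertible T"
    and top: "\<And>x. (block_restrict (matrix_inv T *v (A *v (T *v x))) :: real ^ 'd) = block_restrict x"
    by simp_all
  interpret restr: linear "block_restrict :: real ^ 'n \<Rightarrow> real ^ 'd" by (rule linear_block_restrict)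
  interpret embed: linear "block_embed :: real ^ 'd \<Rightarrow> real ^ 'n" by (rule linear_block_embed)
  define D where "D x = matrix_inv T *v (A *v x - x)" for x
  \<comment> \<open>The first block of \<open>D x\<close> vanishes, which leaves room for the output
    \<open>C x\<close> without losing information.\<close>
  define F where "F x = D x + block_embed (C *v x)" for x
  have "(block_restrict (D x) :: real ^ 'd) = 0" for x
    using top[of "matrix_inv T *v x"]
    by (simp add: D_def matrix_inv_mult_vec[OF T] matrix_vector_mult_diff_distrib restr.diff)
  hence restr_F: "block_restrict (F x) = C *v x" for x
    by (simp add: F_def restr.add block_restrict_embed[OF dn])
  have D0: "D x = 0 \<longleftrightarrow> A *v x = x" for x
    unfolding D_def using matrix_inv_mult_vec(2)[OF T, of "A *v x - x"] by auto
  \<comment> \<open>Restriction to the first block recovers \<open>z = C x\<close>; what remains is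
    \<open>D x = 0\<close>, the fixed-point equation.\<close>
  have iff: "F x = block_embed z \<longleftrightarrow> x = A *v x \<and> z = C *v x" for x z
  proof
    assume F: "F x = block_embed z"
    hence "C *v x = z" using restr_F[of x] by (simp add: block_restrict_embed[OF dn])
    with F D0 show "x = A *v x \<and> z = C *v x" by (simp add: F_def)
  qed (use D0 in \<open>simp add: F_def\<close>)
  have "linear F"
    unfolding F_def D_def
    by (rule linearI) (simp_all add: matrix_vector_right_distrib matrix_vector_mult_diff_distrib
        matrix_vector_mult_scaleR embed.add embed.scale algebra_simps)
  moreover have "inj F"
  proof -
    \<comment> \<open>By \<open>iff\<close> at \<open>z = 0\<close>, such an \<open>x\<close> is a
      fixed point of \<open>A\<close> with zero output, which detectability excludes unless
      \<open>x = 0\<close>.\<close>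
    have "x = 0" if "F x = 0" for x
      using iff[of x 0] that detectable_fixed_point_zero[OF det] by (simp add: embed.zero)
    thus ?thesis using \<open>linear F\<close> by (simp add: linear_injective_0)
  qed
  ultimately have "\<exists>!x. F x = block_embed z"
    using linear_injective_imp_surjective[of F] by (metis injD surjD)
  thus ?thesis by (simp only: iff)
qed

theorem theorem2p1:
  fixes m L :: real
    and A :: "real ^ 'n ^ 'n" and B :: "real ^ 'd ^ 'n" and C :: "real ^ 'n ^ 'd"
  assumes "0 < m" and "m < L" and "detectable A C"
  shows
    "((\<forall>f \<in> S_class m L. quadratic_fun f \<longrightarrow>
         (\<forall>x z w. closed_loop A B C f x z w \<longrightarrow>
            (\<exists>zs. z \<longlonglongrightarrow> zs) \<and> w \<longlonglongrightarrow> 0)) \<longrightarrow>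
        schur (A + m *\<^sub>R (B ** C)) \<and>
        (\<exists>T Aa Ba Ca Da. integrator_factorization A B C T Aa Ba Ca Da))
     \<and>
     ((\<exists>T Aa Ba Ca Da. integrator_structure_AC A C T Aa Ba Ca Da) \<longrightarrow>
        (\<forall>zs. \<exists>!xs. xs = A *v xs \<and> zs = C *v xs))"
proof (intro conjI impI)
  assume "\<forall>f \<in> S_class m L. quadratic_fun f \<longrightarrow>
    (\<forall>x z w. closed_loop A B C f x z w \<longrightarrow> (\<exists>zs. z \<longlonglongrightarrow> zs) \<and> w \<longlonglongrightarrow> 0)"
  \<comment> \<open>The hypothesis is specialized to the test functions, which belong to the class
    because \<open>m < L\<close>.\<close>
  hence lim: "w \<longlonglongrightarrow> 0" if "closed_loop A B C (isotropic_quadratic m b) x z w" for b x z w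
    using that isotropic_quadratic_in_S_class[of m L b] quadratic_fun_isotropic_quadratic assms(1,2)
    by (meson less_imp_le)
  show "schur (A + m *\<^sub>R (B ** C))"
    and "\<exists>T Aa Ba Ca Da. integrator_factorization A B C T Aa Ba Ca Da"
    using schur_and_integrator_factorization[OF assms(1,3)] lim by blast+
next
  assume "\<exists>T Aa Ba Ca Da. integrator_structure_AC A C T Aa Ba Ca Da"
  then obtain T Aa Ba Ca Da where "integrator_structure_AC A C T Aa Ba Ca Da" by blast
  from unique_equilibrium[OF assms(3) this]
  show "\<forall>zs. \<exists>!xs. xs = A *v xs \<and> zs = C *v xs" by (rule allI)
qed

end
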